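(* Let $\mathcal{X}\subseteq\mathbb{R}^n$ be a compact convex set, let $f$ be an $(M,\nu)$ generalized self-concordant function with $\nu\ge2$ such that $\mathrm{dom}(f)$ does not contain any straight line, let $\mathbf{x}_0\in\mathcal{X}\cap\mathrm{dom}(f)$, and define the compact set $\mathcal{L}_0=\{\mathbf{x}\in\mathrm{dom}(f)\cap\mathcal{X}: f(\mathbf{x})\le f(\mathbf{x}_0)\}$. Let $\mathbf{x}^*$ be a minimizer of $f$ over $\mathcal{X}$ with $\mathbf{x}^*$ in the interior of $\mathcal{X}\cap\mathrm{dom}(f)$, and let $r>0$ be the largest value such that $\mathcal{B}(\mathbf{x}^*,r)\subseteq\mathcal{X}\cap\mathrm{dom}(f)$. Then the iterates of the Frank-Wolfe algorithm with backtracking (B-FW) started at $\mathbf{x}_0$ satisfy, for all $t\ge1$, $$h(\mathbf{x}_t)\le h(\mathbf{x}_0)\left(1-\frac{\mu_f^{\mathcal{L}_0}}{2\tilde L}\left(\frac rD\right)^2\right)^t,$$ where $\tilde L=\max\{\tau L_f^{\mathcal{L}_0},L_{-1}\}$, $\tau>1$ is the backtracking parameter and $L_{-1}$ is the initial smoothness estimate.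
   Context: Generalized self-concordance: let $f:\mathbb{R}^n\to\mathbb{R}\cup\{+\infty\}$ be a closed convex function whose domain $\mathrm{dom}(f)=\{\mathbf{x}: f(\mathbf{x})<+\infty\}$ is open, with $f\in C^3(\mathrm{dom}(f))$. For $M\ge 0$, $f$ is $(M,\nu)$ generalized self-concordant if for all $\mathbf{x}\in\mathrm{dom}(f)$ and $\mathbf{u},\mathbf{w}\in\mathbb{R}^n$ (with $\mathbf{w}\ne 0$ if $\nu>3$) $$|\langle D^3f(\mathbf{x})[\mathbf{w}]\mathbf{u},\mathbf{u}\rangle|\le M\,\|\mathbf{u}\|_{\nabla^2f(\mathbf{x})}^2\,\|\mathbf{w}\|_{\nabla^2f(\mathbf{x})}^{\nu-2}\,\|\mathbf{w}\|_2^{3-\nu},$$ where $D^3f(\mathbf{x})[\mathbf{w}]=\lim_{\alpha\to0}\alpha^{-1}(\nabla^2f(\mathbf{x}+\alpha\mathbf{w})-\nabla^2f(\mathbf{x}))$, $\|\mathbf{u}\|_H^2=\langle H\mathbf{u},\mathbf{u}\rangle$, and $0^0=1$. Notation: $\|\cdot\|$ is the Euclidean norm; $\mathcal{B}(\mathbf{x},r)$ is the open Euclidean ball; $D=\max_{\mathbf{x},\mathbf{y}\in\mathcal{X}}\|\mathbf{x}-\mathbf{y}\|$; $h(\mathbf{x})=f(\mathbf{x})-f(\mathbf{x}^* )$ is the primal gap. For a compact convex $\mathcal{C}\subseteq\mathrm{dom}(f)$, $L_f^{\mathcal{C}}$ and $\mu_f^{\mathcal{C}}$ are the maximum and the minimum,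 respectively, of $\|\mathbf{d}\|^2_{\nabla^2f(\mathbf{u})}/\|\mathbf{d}\|^2$ over $\mathbf{u}\in\mathcal{C}$, $\mathbf{d}\in\mathbb{R}^n\setminus\{0\}$. Procedure Backtrack$(f,\mathbf{x},\mathbf{d},L,\gamma_{\max})$ with fixed parameters $\tau>1$ and $0<\eta\le1$: choose a starting value $K\in[\eta L,L]$ and set $\gamma=\min\{-\langle\nabla f(\mathbf{x}),\mathbf{d}\rangle/(K\|\mathbf{d}\|^2),\gamma_{\max}\}$ (with $\gamma=0$ if $\mathbf{d}=0$). While $\mathbf{x}+\gamma\mathbf{d}\notin\mathrm{dom}(f)$ or $f(\mathbf{x}+\gamma\mathbf{d})-f(\mathbf{x})>\frac{K\gamma^2}{2}\|\mathbf{d}\|^2+\gamma\langle\nabla f(\mathbf{x}),\mathbf{d}\rangle$, replace $K$ by $\tau K$ and recompute $\gamma$ by the same formula. Return the final pair $(\gamma,K)$. B-FW: given $\mathbf{x}_0\in\mathcal{X}\cap\mathrm{dom}(f)$ and $L_{-1}>0$, for $t=0,1,\dots$: choose $\mathbf{v}_t\in\arg\min_{\mathbf{v}\in\mathcal{X}}\langle\nabla f(\mathbf{x}_t),\mathbf{v}\rangle$ (any minimizer), let $(\gamma_t,L_t)$ be the output of Backtrack$(f,\mathbf{x}_t,\mathbf{v}_t-\mathbf{x}_t,L_{t-1},1)$, and set $\mathbf{x}_{t+1}=\mathbf{x}_t+\gamma_t(\mathbf{v}_t-\mathbf{x}_t)$. *)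

theory Defs
  imports "HOL-Analysis.Analysis" "HOL-Library.While_Combinator"
begin

section \<open>Functions with values in the reals extended by plus infinity\<close>

definition edom :: "('a \<Rightarrow> ereal) \<Rightarrow> 'a set" where
  "edom f = {x. f x < \<infinity>}"

definition eepigraph :: "('a \<Rightarrow> ereal) \<Rightarrow> ('a \<times> real) set" where
  "eepigraph f = {(x, s). f x \<le> ereal s}"

definition closed_convex_fun :: "('a::real_normed_vector \<Rightarrow> ereal) \<Rightarrow> bool" where
  "closed_convex_fun f \<longleftrightarrow>
     (\<forall>x. f x \<noteq> -\<infinity>) \<and> closed (eepigraph f) \<and> convex (eepigraph f)"

definition contains_line :: "'a::real_vector set \<Rightarrow> bool" where
  "contains_line S \<longleftrightarrow> (\<exists>a d. d \<noteq> 0 \<and> (\<forall>s::real. a + s *\<^sub>R d \<in> S))"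

section \<open>Derivatives up to order three\<close>

text \<open>The derivatives are those of \<open>real_of_ereal \<circ> f\<close>. They are meaningful at points of
  the domain, where this function agrees with \<open>f\<close> on a neighbourhood once the domain is open.\<close>

definition grad :: "(real^'n \<Rightarrow> ereal) \<Rightarrow> real^'n \<Rightarrow> real^'n" where
  "grad f x = (\<chi> i. frechet_derivative (\<lambda>y. real_of_ereal (f y)) (at x) (axis i 1))"

definition hess :: "(real^'n \<Rightarrow> ereal) \<Rightarrow> real^'n \<Rightarrow> real^'n^'n" where
  "hess f x = matrix (frechet_derivative (grad f) (at x))"

definition D3 :: "(real^'n \<Rightarrow> ereal) \<Rightarrow> real^'n \<Rightarrow> real^'n \<Rightarrow> real^'n^'n" where
  "D3 f x w = Lim (at 0) (\<lambda>a::real. inverse a *\<^sub>R (hess f (x + a *\<^sub>R w) - hess f x))"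

text \<open>\<open>f \<in> C\<^sup>3(dom f)\<close>, for an open domain: continuity of the lower derivatives
  follows from differentiability, so it is required of the third derivative only.\<close>

definition C3_on_edom :: "(real^'n \<Rightarrow> ereal) \<Rightarrow> bool" where
  "C3_on_edom f \<longleftrightarrow>
     (\<lambda>y. real_of_ereal (f y)) differentiable_on edom f \<and>
     grad f differentiable_on edom f \<and>
     hess f differentiable_on edom f \<and>
     (\<forall>w. continuous_on (edom f) (\<lambda>x. D3 f x w))"

section \<open>Generalized self-concordance\<close>

definition sqnorm_by :: "real^'n^'n \<Rightarrow> real^'n \<Rightarrow> real" where
  "sqnorm_by H u = (H *v u) \<bullet> u"

definition norm_by :: "real^'n^'n \<Rightarrow> real^'n \<Rightarrow> real" where
  "norm_by H u = sqrt (sqnorm_by H u)"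

text \<open>Real power with the convention \<open>0\<^sup>0 = 1\<close>, whereas \<open>0 powr 0 = 0\<close>.\<close>

definition powr01 :: "real \<Rightarrow> real \<Rightarrow> real" where
  "powr01 x a = (if x = 0 \<and> a = 0 then 1 else x powr a)"

definition gen_self_concordant :: "real \<Rightarrow> real \<Rightarrow> (real^'n \<Rightarrow> ereal) \<Rightarrow> bool" where
  "gen_self_concordant M \<nu> f \<longleftrightarrow>
     0 \<le> M \<and> closed_convex_fun f \<and> open (edom f) \<and> C3_on_edom f \<and>
     (\<forall>x\<in>edom f. \<forall>u w. (\<nu> > 3 \<longrightarrow> w \<noteq> 0) \<longrightarrow>
        \<bar>(D3 f x w *v u) \<bullet> u\<bar>
          \<le> M * sqnorm_by (hess f x) u
              * powr01 (norm_by (hess f x) w) (\<nu> - 2) * powr01 (norm w) (3 - \<nu>))"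

section \<open>Extreme curvature over a set\<close>

text \<open>On a nonempty compact subset of the domain, the supremum and the infimum below are
  attained, hence they are the maximum and the minimum.\<close>

definition curvature_ratios :: "(real^'n \<Rightarrow> ereal) \<Rightarrow> (real^'n) set \<Rightarrow> real set" where
  "curvature_ratios f C = {sqnorm_by (hess f u) d / (norm d)\<^sup>2 | u d. u \<in> C \<and> d \<noteq> 0}"

definition L_max :: "(real^'n \<Rightarrow> ereal) \<Rightarrow> (real^'n) set \<Rightarrow> real" where
  "L_max f C = Sup (curvature_ratios f C)"

definition mu_min :: "(real^'n \<Rightarrow> ereal) \<Rightarrow> (real^'n) set \<Rightarrow> real" where
  "mu_min f C = Inf (curvature_ratios f C)"

definition initial_sublevel :: "('a \<Rightarrow> ereal) \<Rightarrow> 'a set \<Rightarrow> 'a \<Rightarrow> 'a set" where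
  "initial_sublevel f X x0 = {x \<in> edom f \<inter> X. f x \<le> f x0}"

lemma compact_initial_sublevel:
  assumes "closed_convex_fun f" "compact X" "x0 \<in> edom f"
  shows "compact (initial_sublevel f X x0)"
proof -
  obtain c where c: "f x0 = ereal c"
    using assms(1,3) by (cases "f x0") (auto simp: closed_convex_fun_def edom_def)
  have "closed ((\<lambda>x. (x, c)) -` eepigraph f)"
    using assms(1) by (intro closed_vimage) (auto simp: closed_convex_fun_def intro!: continuous_intros)
  moreover have "initial_sublevel f X x0 = X \<inter> (\<lambda>x. (x, c)) -` eepigraph f"
    by (auto simp: initial_sublevel_def edom_def eepigraph_def c)
  ultimately show ?thesis
    using assms(2) by (simp add: compact_Int_closed)
qed

lemma convex_initial_sublevel:
  assumes "closed_convex_fun f" "convex X" "x0 \<in> edom f"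
  shows "convex (initial_sublevel f X x0)"
proof -
  obtain c where c: "f x0 = ereal c"
    using assms(1,3) by (cases "f x0") (auto simp: closed_convex_fun_def edom_def)
  have E: "convex (eepigraph f)"
    using assms(1) by (simp add: closed_convex_fun_def)
  have "convex ((\<lambda>x. (x, c)) -` eepigraph f)"
  proof (rule convexI)
    fix x y and u v :: real
    assume "x \<in> (\<lambda>x. (x, c)) -` eepigraph f" "y \<in> (\<lambda>x. (x, c)) -` eepigraph f"
      and uv: "0 \<le> u" "0 \<le> v" "u + v = 1"
    then have "u *\<^sub>R (x, c) + v *\<^sub>R (y, c) \<in> eepigraph f"
      using convexD[OF E] by auto
    moreover have "u * c + v * c = c"
      using uv by (metis distrib_right mult_1)
    ultimately show "u *\<^sub>R x + v *\<^sub>R y \<in> (\<lambda>x. (x, c)) -` eepigraph f"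
      by simp
  qed
  moreover have "initial_sublevel f X x0 = X \<inter> (\<lambda>x. (x, c)) -` eepigraph f"
    by (auto simp: initial_sublevel_def edom_def eepigraph_def c)
  ultimately show ?thesis
    using assms(2) by (simp add: convex_Int)
qed

section \<open>The Frank-Wolfe algorithm with backtracking\<close>

definition bt_step :: "(real^'n \<Rightarrow> ereal) \<Rightarrow> real^'n \<Rightarrow> real^'n \<Rightarrow> real \<Rightarrow> real \<Rightarrow> real" where
  "bt_step f x d \<gamma>max K =
     (if d = 0 then 0 else min (- (grad f x \<bullet> d) / (K * (norm d)\<^sup>2)) \<gamma>max)"

definition bt_reject :: "(real^'n \<Rightarrow> ereal) \<Rightarrow> real^'n \<Rightarrow> real^'n \<Rightarrow> real \<times> real \<Rightarrow> bool" where
  "bt_reject f x d = (\<lambda>(\<gamma>, K).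
     x + \<gamma> *\<^sub>R d \<notin> edom f \<or>
     f (x + \<gamma> *\<^sub>R d) - f x > ereal (K * \<gamma>\<^sup>2 / 2 * (norm d)\<^sup>2 + \<gamma> * (grad f x \<bullet> d)))"

text \<open>The set of possible results \<open>(\<gamma>, K)\<close>, one for each admissible starting value.
  Since \<^const>\<open>while\<close> is unspecified on a diverging loop, statements about the
  results implicitly require termination.\<close>

definition backtrack ::
  "real \<Rightarrow> real \<Rightarrow> (real^'n \<Rightarrow> ereal) \<Rightarrow> real^'n \<Rightarrow> real^'n \<Rightarrow> real \<Rightarrow> real \<Rightarrow> (real \<times> real) set" where
  "backtrack \<tau> \<eta> f x d L \<gamma>max =
     {while (bt_reject f x d) (\<lambda>(\<gamma>, K). (bt_step f x d \<gamma>max (\<tau> * K), \<tau> * K))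
        (bt_step f x d \<gamma>max K0, K0) | K0. \<eta> * L \<le> K0 \<and> K0 \<le> L}"

text \<open>The sequence of smoothness estimates is shifted by one: \<open>L 0\<close> is the initial
  estimate $L_{-1}$ and \<open>L (Suc t)\<close> is $L_t$.\<close>

definition bfw_run ::
  "real \<Rightarrow> real \<Rightarrow> (real^'n \<Rightarrow> ereal) \<Rightarrow> (real^'n) set \<Rightarrow> real^'n \<Rightarrow> real \<Rightarrow>
   (nat \<Rightarrow> real^'n) \<Rightarrow> (nat \<Rightarrow> real^'n) \<Rightarrow> (nat \<Rightarrow> real) \<Rightarrow> (nat \<Rightarrow> real) \<Rightarrow> bool" where
  "bfw_run \<tau> \<eta> f X x0 Linit x v \<gamma> L \<longleftrightarrow>
     x 0 = x0 \<and> L 0 = Linit \<and>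
     (\<forall>t. is_arg_min (\<lambda>z. grad f (x t) \<bullet> z) (\<lambda>z. z \<in> X) (v t) \<and>
          (\<gamma> t, L (Suc t)) \<in> backtrack \<tau> \<eta> f (x t) (v t - x t) (L t) 1 \<and>
          x (Suc t) = x t + \<gamma> t *\<^sub>R (v t - x t))"

text \<open>Kept in \<^typ>\<open>ereal\<close>, so that the gap is infinite outside the domain.\<close>

definition primal_gap :: "('a \<Rightarrow> ereal) \<Rightarrow> 'a \<Rightarrow> 'a \<Rightarrow> ereal" where
  "primal_gap f xstar x = f x - f xstar"

end

theory Submission
  imports Defs
begin

text \<open>Write \<open>\<mu>\<close> and \<open>L\<close> for the extreme curvatures on the convex compact sublevel set. Since
  \<open>f\<close> is \<open>L\<close>-smooth there and the step stays inside as soon as the estimate reaches \<open>L\<close>, every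
  accepted estimate \<open>K\<close> is at most \<open>max (\<tau> * L) Linit\<close>. Comparing the linear minimizer
  with the point of the ball around \<open>xstar\<close> that lies furthest against the gradient \<open>g\<close>, the direction
  \<open>d\<close> satisfies \<open>- g \<bullet> d \<ge> h + r * norm g\<close>, and strong convexity gives \<open>(norm g)\<^sup>2 \<ge> 2 * \<mu> * h\<close>.
  A full step then halves the gap \<open>h\<close>, and a short step decreases it by
  \<open>(g \<bullet> d)\<^sup>2 / (2 * K * (norm d)\<^sup>2) \<ge> \<mu> * h / K * (r / D)\<^sup>2\<close>. If \<open>\<mu> \<le> 0\<close>, monotonicity of the
  gap suffices.\<close>

section \<open>Derivatives on the domain and second-order Taylor expansion\<close>

lemma ereal_real_of_edom:
  assumes "closed_convex_fun f" "x \<in> edom f"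
  shows "ereal (real_of_ereal (f x)) = f x"
  using assms by (cases "f x") (auto simp: closed_convex_fun_def edom_def)

lemma has_derivative_grad:
  fixes f :: "real^'n \<Rightarrow> ereal"
  assumes "C3_on_edom f" "open (edom f)" "x \<in> edom f"
  shows "((\<lambda>y. real_of_ereal (f y)) has_derivative (\<lambda>v. grad f x \<bullet> v)) (at x)"
proof -
  let ?F = "\<lambda>y. real_of_ereal (f y)" and ?F' = "frechet_derivative (\<lambda>y. real_of_ereal (f y)) (at x)"
  have "?F differentiable at x"
    using assms by (auto simp: C3_on_edom_def differentiable_on_def at_within_open[OF assms(3,2)])
  then have D: "(?F has_derivative ?F') (at x)"
    by (simp add: frechet_derivative_works)
  then have lin: "linear ?F'"
    by (rule has_derivative_linear)
  have "?F' v = grad f x \<bullet> v" for v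
  proof -
    have "?F' v = ?F' (\<Sum>i\<in>UNIV. v $ i *\<^sub>R axis i 1)"
      using basis_expansion[of v] by (simp add: scalar_mult_eq_scaleR)
    also have "\<dots> = (\<Sum>i\<in>UNIV. v $ i * ?F' (axis i 1))"
      by (simp add: linear_sum[OF lin] linear_scale[OF lin])
    finally show ?thesis
      by (simp add: grad_def inner_vec_def mult.commute)
  qed
  with D show ?thesis
    by (metis (no_types, lifting) ext)
qed

lemma has_derivative_hess:
  fixes f :: "real^'n \<Rightarrow> ereal"
  assumes "C3_on_edom f" "open (edom f)" "x \<in> edom f"
  shows "(grad f has_derivative (\<lambda>v. hess f x *v v)) (at x)"
proof -
  have "grad f differentiable at x"
    using assms by (auto simp: C3_on_edom_def differentiable_on_def at_within_open[OF assms(3,2)])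
  then have D: "(grad f has_derivative frechet_derivative (grad f) (at x)) (at x)"
    by (simp add: frechet_derivative_works)
  then show ?thesis
    using matrix_works[of "frechet_derivative (grad f) (at x)"] has_derivative_linear[OF D]
    by (simp add: hess_def linear_matrix_vector_mul_eq)
qed

text \<open>Restricting \<open>f\<close> to the line through \<open>x\<close> and \<open>y\<close>
  reduces this to the one-dimensional Taylor theorem. The remainder is kept exact, at a single point
  of the segment, so that one expansion yields both the smoothness and the strong convexity
  inequality.\<close>

lemma Taylor_order2_edom:
  fixes f :: "real^'n \<Rightarrow> ereal"
  assumes f: "C3_on_edom f" "open (edom f)" and seg: "closed_segment x y \<subseteq> edom f"
  obtains \<xi> where "\<xi> \<in> closed_segment x y"
    "real_of_ereal (f y)
      = real_of_ereal (f x) + grad f x \<bullet> (y - x) + sqnorm_by (hess f \<xi>) (y - x) / 2"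
proof -
  define p where "p s = x + s *\<^sub>R (y - x)" for s :: real
  have p_seg: "p s \<in> closed_segment x y" if "0 \<le> s" "s \<le> 1" for s
    using that by (auto simp: p_def closed_segment_def algebra_simps intro!: exI[of _ s])
  have p': "(p has_derivative (\<lambda>h. h *\<^sub>R (y - x))) (at s)" for s
    unfolding p_def by (auto intro!: derivative_eq_intros)
  \<comment> \<open>Derivatives of the restriction, indexed by order as \<open>Taylor_up\<close>
    expects; only the orders 0, 1 and 2 matter.\<close>
  define D where "D m s = (if m = 0 then real_of_ereal (f (p s))
     else if m = 1 then grad f (p s) \<bullet> (y - x) else sqnorm_by (hess f (p s)) (y - x))"
    for m :: nat and s
  have D0: "DERIV (D 0) s :> D 1 s" and D1: "DERIV (D 1) s :> D 2 s" if s: "0 \<le> s" "s \<le> 1" for s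
  proof -
    have ps: "p s \<in> edom f"
      using p_seg[OF s] seg by blast
    have "((\<lambda>s. real_of_ereal (f (p s))) has_derivative (\<lambda>h. grad f (p s) \<bullet> (h *\<^sub>R (y - x)))) (at s)"
      by (rule has_derivative_compose[OF p' has_derivative_grad[OF f ps]])
    then show "DERIV (D 0) s :> D 1 s"
      by (simp add: D_def[abs_def] has_field_derivative_def mult_commute_abs)
    have "((\<lambda>s. grad f (p s)) has_derivative (\<lambda>h. hess f (p s) *v (h *\<^sub>R (y - x)))) (at s)"
      by (rule has_derivative_compose[OF p' has_derivative_hess[OF f ps]])
    then have "((\<lambda>s. grad f (p s) \<bullet> (y - x)) has_derivative
        (\<lambda>h. (hess f (p s) *v (h *\<^sub>R (y - x))) \<bullet> (y - x))) (at s)"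
      by (rule has_derivative_inner_left)
    then show "DERIV (D 1) s :> D 2 s"
      by (simp add: D_def[abs_def] has_field_derivative_def sqnorm_by_def mult_commute_abs
          matrix_vector_mult_scaleR)
  qed
  have "\<exists>s>0. s < 1 \<and> D 0 1 = (\<Sum>m<2. D m 0 / fact m * (1 - 0) ^ m) + D 2 s / fact 2 * (1 - 0)\<^sup>2"
  proof (rule Taylor_up)
    show "\<forall>m t. m < 2 \<and> 0 \<le> t \<and> t \<le> 1 \<longrightarrow> DERIV (D m) t :> D (Suc m) t"
      using D0 D1 by (auto dest!: less_2_cases simp flip: numeral_2_eq_2)
  qed auto
  then obtain s where s: "0 < s" "s < 1" and eq: "D 0 1 = D 0 0 + D 1 0 + D 2 s / 2"
    by (auto simp: numeral_2_eq_2)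
  show thesis
    using that[OF p_seg[of s]] s eq by (simp add: D_def p_def)
qed

section \<open>Curvature bounds on compact subsets of the domain\<close>

text \<open>The ratio does not change when \<open>d\<close> is rescaled, so every ratio is a value
  of a continuous function on the compact set \<open>C\<close> times the unit sphere. Boundedness is
  what gives the \<open>Sup\<close> and \<open>Inf\<close> in \<open>L_max\<close> and
  \<open>mu_min\<close> their meaning.\<close>

lemma
  fixes f :: "real^'n \<Rightarrow> ereal"
  assumes f: "C3_on_edom f" and C: "compact C" "C \<subseteq> edom f"
  shows bdd_above_curvature_ratios: "bdd_above (curvature_ratios f C)"
    and bdd_below_curvature_ratios: "bdd_below (curvature_ratios f C)"
proof -
  have "continuous_on C (hess f)"
    using f C(2) by (meson C3_on_edom_def continuous_on_subset differentiable_imp_continuous_on)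
  then have cont: "continuous_on (C \<times> sphere 0 1) (\<lambda>z. (hess f (fst z) *v snd z) \<bullet> snd z)"
    unfolding matrix_vector_mult_def
    by (intro continuous_intros continuous_on_compose2[of C "hess f" _ fst]) auto
  have "compact ((\<lambda>z. (hess f (fst z) *v snd z) \<bullet> snd z) ` (C \<times> sphere 0 1))"
    by (rule compact_continuous_image[OF cont]) (simp add: C compact_Times)
  moreover have "curvature_ratios f C \<subseteq> (\<lambda>z. (hess f (fst z) *v snd z) \<bullet> snd z) ` (C \<times> sphere 0 1)"
  proof
    fix q assume "q \<in> curvature_ratios f C"
    then obtain u d where ud: "u \<in> C" "d \<noteq> 0" "q = sqnorm_by (hess f u) d / (norm d)\<^sup>2"
      by (auto simp: curvature_ratios_def)
    then have "q = (hess f u *v (d /\<^sub>R norm d)) \<bullet> (d /\<^sub>R norm d)"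
      by (simp add: sqnorm_by_def matrix_vector_mult_scaleR power2_eq_square divide_simps)
    with ud show "q \<in> (\<lambda>z. (hess f (fst z) *v snd z) \<bullet> snd z) ` (C \<times> sphere 0 1)"
      by (intro image_eqI[of _ _ "(u, d /\<^sub>R norm d)"]) auto
  qed
  ultimately have "bounded (curvature_ratios f C)"
    by (meson bounded_subset compact_imp_bounded)
  then show "bdd_above (curvature_ratios f C)" "bdd_below (curvature_ratios f C)"
    by (rule bounded_imp_bdd_above, rule bounded_imp_bdd_below)
qed

lemma
  fixes f :: "real^'n \<Rightarrow> ereal"
  assumes f: "C3_on_edom f" and C: "compact C" "C \<subseteq> edom f" and u: "u \<in> C"
  shows sqnorm_by_le_L_max: "sqnorm_by (hess f u) d \<le> L_max f C * (norm d)\<^sup>2"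
    and sqnorm_by_ge_mu_min: "mu_min f C * (norm d)\<^sup>2 \<le> sqnorm_by (hess f u) d"
proof -
  have "sqnorm_by (hess f u) d \<le> L_max f C * (norm d)\<^sup>2
      \<and> mu_min f C * (norm d)\<^sup>2 \<le> sqnorm_by (hess f u) d"
  proof (cases "d = 0")
    case False
    then have "sqnorm_by (hess f u) d / (norm d)\<^sup>2 \<in> curvature_ratios f C"
      using u by (auto simp: curvature_ratios_def)
    then have "sqnorm_by (hess f u) d / (norm d)\<^sup>2 \<le> L_max f C"
      "mu_min f C \<le> sqnorm_by (hess f u) d / (norm d)\<^sup>2"
      unfolding L_max_def mu_min_def
      using bdd_above_curvature_ratios[OF f C] bdd_below_curvature_ratios[OF f C]
      by (auto intro: cSup_upper cInf_lower)
    then show ?thesis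
      using False by (simp add: field_simps)
  qed (simp add: sqnorm_by_def)
  then show "sqnorm_by (hess f u) d \<le> L_max f C * (norm d)\<^sup>2"
    "mu_min f C * (norm d)\<^sup>2 \<le> sqnorm_by (hess f u) d" by auto
qed

lemma mu_min_le_L_max:
  fixes f :: "real^'n \<Rightarrow> ereal"
  assumes "C3_on_edom f" "compact C" "C \<subseteq> edom f" "C \<noteq> {}"
  shows "mu_min f C \<le> L_max f C"
proof -
  obtain u d where "u \<in> C" "norm (d::real^'n) = 1"
    using assms(4) norm_axis_1 by blast
  then show ?thesis
    using sqnorm_by_le_L_max[OF assms(1-3), of u d] sqnorm_by_ge_mu_min[OF assms(1-3), of u d] by simp
qed

text \<open>Convexity of \<open>C\<close> keeps the Taylor point of the segment inside
  \<open>C\<close>, where the extreme curvatures bound the quadratic term from both sides.\<close>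

lemma
  fixes f :: "real^'n \<Rightarrow> ereal"
  assumes f: "C3_on_edom f" "open (edom f)"
    and C: "compact C" "convex C" "C \<subseteq> edom f" and xy: "x \<in> C" "y \<in> C"
  shows quadratic_upper_bound: "real_of_ereal (f y)
      \<le> real_of_ereal (f x) + grad f x \<bullet> (y - x) + L_max f C / 2 * (norm (y - x))\<^sup>2"
    and quadratic_lower_bound: "real_of_ereal (f x) + grad f x \<bullet> (y - x) + mu_min f C / 2 * (norm (y - x))\<^sup>2
      \<le> real_of_ereal (f y)"
proof -
  have seg: "closed_segment x y \<subseteq> C"
    using C(2) xy by (simp add: closed_segment_subset)
  with C(3) have "closed_segment x y \<subseteq> edom f" by blast
  then obtain \<xi> where \<xi>: "\<xi> \<in> closed_segment x y"
    and eq: "real_of_ereal (f y)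
      = real_of_ereal (f x) + grad f x \<bullet> (y - x) + sqnorm_by (hess f \<xi>) (y - x) / 2"
    using Taylor_order2_edom[OF f] by blast
  have "\<xi> \<in> C" using \<xi> seg by blast
  from sqnorm_by_le_L_max[OF f(1) C(1,3) this, of "y - x"]
    sqnorm_by_ge_mu_min[OF f(1) C(1,3) this, of "y - x"] eq
  show "real_of_ereal (f y)
      \<le> real_of_ereal (f x) + grad f x \<bullet> (y - x) + L_max f C / 2 * (norm (y - x))\<^sup>2"
    "real_of_ereal (f x) + grad f x \<bullet> (y - x) + mu_min f C / 2 * (norm (y - x))\<^sup>2
      \<le> real_of_ereal (f y)"
    by auto
qed

text \<open>A Polyak-Lojasiewicz inequality: the lower quadratic bound limits the gap to a concave
  quadratic in the distance from \<open>x\<close> to \<open>y\<close>, and completing the square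
  removes that unknown distance.\<close>

lemma gradient_dominance:
  fixes f :: "real^'n \<Rightarrow> ereal"
  assumes f: "C3_on_edom f" "open (edom f)"
    and C: "compact C" "convex C" "C \<subseteq> edom f" and xy: "x \<in> C" "y \<in> C"
    and pos: "mu_min f C > 0"
  shows "2 * mu_min f C * (real_of_ereal (f x) - real_of_ereal (f y)) \<le> (norm (grad f x))\<^sup>2"
proof -
  let ?m = "mu_min f C" and ?a = "norm (y - x)" and ?g = "norm (grad f x)"
  have "real_of_ereal (f x) - real_of_ereal (f y) \<le> - (grad f x \<bullet> (y - x)) - ?m / 2 * ?a\<^sup>2"
    using quadratic_lower_bound[OF f C xy] by simp
  also have "\<dots> \<le> ?g * ?a - ?m / 2 * ?a\<^sup>2"
    using Cauchy_Schwarz_ineq2[of "grad f x" "y - x"] by linarith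
  finally have "2 * ?m * (real_of_ereal (f x) - real_of_ereal (f y)) \<le> 2 * ?m * (?g * ?a - ?m / 2 * ?a\<^sup>2)"
    using pos by (intro mult_left_mono) auto
  also have "\<dots> = ?g\<^sup>2 - (?g - ?m * ?a)\<^sup>2"
    by (simp add: power2_eq_square algebra_simps)
  also have "\<dots> \<le> ?g\<^sup>2" by simp
  finally show ?thesis .
qed

section \<open>The backtracking line search\<close>

text \<open>The last inequality survives truncation of the step at 1. It says that the quadratic
  term of the model is at most half of the linear decrease.\<close>

lemma bt_step_bounds:
  assumes "grad f x \<bullet> d \<le> 0" "K > 0"
  shows "0 \<le> bt_step f x d 1 K" "bt_step f x d 1 K \<le> 1"
    "K * bt_step f x d 1 K * (norm d)\<^sup>2 \<le> - (grad f x \<bullet> d)"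
proof -
  show "0 \<le> bt_step f x d 1 K" "bt_step f x d 1 K \<le> 1"
    using assms by (auto simp: bt_step_def divide_nonpos_nonneg)
  show "K * bt_step f x d 1 K * (norm d)\<^sup>2 \<le> - (grad f x \<bullet> d)"
  proof (cases "d = 0")
    case False
    then have "bt_step f x d 1 K \<le> - (grad f x \<bullet> d) / (K * (norm d)\<^sup>2)"
      by (simp add: bt_step_def)
    then show ?thesis
      using False assms(2) by (simp add: field_simps)
  qed simp
qed

lemma not_bt_reject_iff:
  assumes "closed_convex_fun f" "x \<in> edom f"
  shows "\<not> bt_reject f x d (\<gamma>, K) \<longleftrightarrow> x + \<gamma> *\<^sub>R d \<in> edom f \<and>
    real_of_ereal (f (x + \<gamma> *\<^sub>R d))
      \<le> real_of_ereal (f x) + K * \<gamma>\<^sup>2 / 2 * (norm d)\<^sup>2 + \<gamma> * (grad f x \<bullet> d)"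
proof (cases "x + \<gamma> *\<^sub>R d \<in> edom f")
  case True
  have "f (x + \<gamma> *\<^sub>R d) - f x = ereal (real_of_ereal (f (x + \<gamma> *\<^sub>R d)) - real_of_ereal (f x))"
    using ereal_real_of_edom[OF assms] ereal_real_of_edom[OF assms(1) True] by (metis ereal_minus(1))
  with True show ?thesis
    by (auto simp: bt_reject_def)
qed (simp add: bt_reject_def)

lemma mem_initial_sublevel_iff:
  assumes "closed_convex_fun f" "x0 \<in> edom f"
  shows "x \<in> initial_sublevel f X x0 \<longleftrightarrow>
    x \<in> edom f \<and> x \<in> X \<and> real_of_ereal (f x) \<le> real_of_ereal (f x0)"
proof (cases "x \<in> edom f")
  case True
  then obtain a b where "f x = ereal a" "f x0 = ereal b"
    using ereal_real_of_edom[OF assms(1)] assms(2) by metis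
  then show ?thesis
    by (simp add: initial_sublevel_def)
qed (simp add: initial_sublevel_def)

text \<open>The point \<open>x + s *\<^sub>R d\<close> cannot leave the sublevel set before \<open>s\<close> reaches the step size:
  at a last point inside, either \<open>s = 0\<close> and \<open>d\<close> is a descent direction, or the quadratic
  bound, available up to that point, puts \<open>f\<close> strictly below its value at \<open>x\<close>.\<close>

lemma bt_step_mem_initial_sublevel:
  fixes f :: "real^'n \<Rightarrow> ereal" and X x0
  defines "C \<equiv> initial_sublevel f X x0"
  assumes f: "closed_convex_fun f" "C3_on_edom f" "open (edom f)"
    and X: "compact X" "convex X" and x0: "x0 \<in> edom f"
    and x: "x \<in> C" "x + d \<in> X" and descent: "grad f x \<bullet> d \<le> 0"
    and K: "K > 0" "L_max f C \<le> K"
  shows "x + bt_step f x d 1 K *\<^sub>R d \<in> C"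
proof -
  let ?F = "\<lambda>y. real_of_ereal (f y)"
  define \<gamma> where "\<gamma> = bt_step f x d 1 K"
  have \<gamma>: "0 \<le> \<gamma>" "\<gamma> \<le> 1" "K * \<gamma> * (norm d)\<^sup>2 \<le> - (grad f x \<bullet> d)"
    using bt_step_bounds[where f=f, OF descent K(1)] by (auto simp: \<gamma>_def)
  have C: "compact C" "convex C" "C \<subseteq> edom f"
    using compact_initial_sublevel[OF f(1) X(1) x0] convex_initial_sublevel[OF f(1) X(2) x0]
    by (auto simp: C_def initial_sublevel_def)
  note C_iff = mem_initial_sublevel_iff[OF f(1) x0, of _ X, folded C_def]
  have xd_X: "x + s *\<^sub>R d \<in> X" if "0 \<le> s" "s \<le> 1" for s
  proof -
    have "(1 - s) *\<^sub>R x + s *\<^sub>R (x + d) \<in> X"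
      using X(2) x that C_iff by (intro convexD) auto
    then show ?thesis by (simp add: algebra_simps)
  qed
  \<comment> \<open>\<open>S\<close> is compact, hence has a last point \<open>s\<close>; if
    \<open>s\<close> were smaller than the step, membership could be prolonged slightly beyond
    it.\<close>
  define S where "S = {0..\<gamma>} \<inter> (\<lambda>s. x + s *\<^sub>R d) -` C"
  have "compact S"
    unfolding S_def using compact_imp_closed[OF C(1)]
    by (intro compact_Int_closed closed_vimage) (auto intro!: continuous_intros)
  moreover have "0 \<in> S"
    using x \<gamma> by (simp add: S_def)
  ultimately obtain s where s: "s \<in> S" and s_max: "\<And>s'. s' \<in> S \<Longrightarrow> s' \<le> s"
    using compact_attains_sup[of S] by blast
  have s0: "0 \<le> s" "s \<le> \<gamma>" and sC: "x + s *\<^sub>R d \<in> C"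
    using s by (auto simp: S_def)
  have "s = \<gamma>"
  proof (rule ccontr)
    assume "s \<noteq> \<gamma>"
    with s0 have "s < \<gamma>" by simp
    then have "d \<noteq> 0"
      using s0 by (auto simp: \<gamma>_def bt_step_def)
    \<comment> \<open>For \<open>s = 0\<close> this says that the directional derivative is strictly
      negative.\<close>
    with \<open>s < \<gamma>\<close> K have less: "K * s * (norm d)\<^sup>2 < - (grad f x \<bullet> d)"
      by (intro less_le_trans[OF _ \<gamma>(3)]) auto
    have "continuous (at_right s) (\<lambda>s'. x + s' *\<^sub>R d)"
      by (intro continuous_intros)
    then have lim: "((\<lambda>s'. x + s' *\<^sub>R d) \<longlongrightarrow> x + s *\<^sub>R d) (at_right s)"
      by (simp add: continuous_within)
    have in_dom: "\<forall>\<^sub>F s' in at_right s. x + s' *\<^sub>R d \<in> edom f"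
      using topological_tendstoD[OF lim f(3)] sC C(3) by auto
    have le: "\<forall>\<^sub>F s' in at_right s. ?F (x + s' *\<^sub>R d) \<le> ?F x"
    proof (cases "s = 0")
      case True
      have p': "((\<lambda>s. x + s *\<^sub>R d) has_derivative (\<lambda>h. h *\<^sub>R d)) (at 0)"
        by (auto intro!: derivative_eq_intros)
      have "((\<lambda>s. ?F (x + s *\<^sub>R d)) has_derivative (\<lambda>h. grad f x \<bullet> (h *\<^sub>R d))) (at 0)"
        using has_derivative_compose[OF p', of ?F "\<lambda>v. grad f x \<bullet> v"]
          has_derivative_grad[OF f(2,3)] x(1) C(3) by auto
      then have "DERIV (\<lambda>s. ?F (x + s *\<^sub>R d)) 0 :> grad f x \<bullet> d"
        by (simp add: has_field_derivative_def mult_commute_abs)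
      from DERIV_neg_dec_right[OF this] less True
      obtain e where "e > 0" "\<forall>h>0. h < e \<longrightarrow> ?F (x + h *\<^sub>R d) < ?F x" by auto
      with True show ?thesis
        by (auto simp: eventually_at_right_field intro!: exI[of _ e] less_imp_le)
    next
      case False
      \<comment> \<open>The bound is used only at \<open>s\<close>, where membership in
        \<open>C\<close> is known. It gives a strict decrease, which continuity then carries to
        points slightly beyond \<open>s\<close>.\<close>
      have "?F (x + s *\<^sub>R d) \<le> ?F x + s * (grad f x \<bullet> d) + L_max f C / 2 * (s\<^sup>2 * (norm d)\<^sup>2)"
        using quadratic_upper_bound[OF f(2,3) C x(1) sC] by (simp add: power_mult_distrib)
      also have "\<dots> \<le> ?F x + s * (grad f x \<bullet> d) + K / 2 * (s\<^sup>2 * (norm d)\<^sup>2)"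
        using K by (simp add: mult_right_mono)
      also have "\<dots> = ?F x + s * (grad f x \<bullet> d) + s / 2 * (K * s * (norm d)\<^sup>2)"
        by (simp add: power2_eq_square)
      also have "\<dots> < ?F x + s * (grad f x \<bullet> d) + s / 2 * (- 2 * (grad f x \<bullet> d))"
        using less False s0 descent by (intro add_strict_left_mono mult_strict_left_mono) auto
      finally have "?F (x + s *\<^sub>R d) < ?F x"
        by simp
      moreover have "isCont ?F (x + s *\<^sub>R d)"
        using has_derivative_continuous[OF has_derivative_grad[OF f(2,3)]] sC C(3) by auto
      then have "((\<lambda>s'. ?F (x + s' *\<^sub>R d)) \<longlongrightarrow> ?F (x + s *\<^sub>R d)) (at_right s)"
        by (rule isCont_tendsto_compose[OF _ lim])
      ultimately have "\<forall>\<^sub>F s' in at_right s. ?F (x + s' *\<^sub>R d) < ?F x"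
        by (intro order_tendstoD(2))
      then show ?thesis
        by (rule eventually_mono) simp
    qed
    \<comment> \<open>Staying below the step size, which is at most 1, keeps the point in
      \<open>X\<close> by convexity.\<close>
    have "\<forall>\<^sub>F s' in at_right s. s' \<in> {s<..<\<gamma>}"
      using \<open>s < \<gamma>\<close> by (rule eventually_at_right_real)
    with in_dom le have "\<forall>\<^sub>F s' in at_right s. s < s' \<and> s' \<in> S"
    proof eventually_elim
      case (elim s')
      then show ?case
        using xd_X[of s'] s0 \<gamma> x(1) by (auto simp: S_def C_iff)
    qed
    then obtain s' where "s < s'" "s' \<in> S"
      using eventually_happens'[OF trivial_limit_at_right_real] by blast
    with s_max show False by fastforce
  qed
  with sC show ?thesis by (simp add: \<gamma>_def)
qed

text \<open>Once the trial point is known to lie in \<open>C\<close>, the acceptance test is the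
  quadratic upper bound with \<open>L_max f C\<close> enlarged to \<open>K\<close>.\<close>

lemma not_bt_reject_ge_L_max:
  fixes f :: "real^'n \<Rightarrow> ereal" and X x0
  defines "C \<equiv> initial_sublevel f X x0"
  assumes f: "closed_convex_fun f" "C3_on_edom f" "open (edom f)"
    and X: "compact X" "convex X" and x0: "x0 \<in> edom f"
    and x: "x \<in> C" "x + d \<in> X" and descent: "grad f x \<bullet> d \<le> 0"
    and K: "K > 0" "L_max f C \<le> K"
  shows "\<not> bt_reject f x d (bt_step f x d 1 K, K)"
proof -
  let ?\<gamma> = "bt_step f x d 1 K"
  have C: "compact C" "convex C" "C \<subseteq> edom f"
    using compact_initial_sublevel[OF f(1) X(1) x0] convex_initial_sublevel[OF f(1) X(2) x0]
    by (auto simp: C_def initial_sublevel_def)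
  have y: "x + ?\<gamma> *\<^sub>R d \<in> C"
    using bt_step_mem_initial_sublevel f X x0 x descent K unfolding C_def by blast
  have "L_max f C / 2 * (norm (?\<gamma> *\<^sub>R d))\<^sup>2 \<le> K / 2 * (norm (?\<gamma> *\<^sub>R d))\<^sup>2"
    using K by (intro mult_right_mono) auto
  with quadratic_upper_bound[OF f(2,3) C x(1) y] show ?thesis
    using x(1) y C(3) by (subst not_bt_reject_iff[OF f(1)]) (auto simp: power_mult_distrib)
qed

text \<open>Geometric growth brings the estimate above \<open>B\<close> after finitely many
  rejections, so the loop terminates. A rejected estimate lies below \<open>B\<close>, so its
  successor lies below \<open>\<tau> * B\<close>; otherwise the starting value, at most
  \<open>L\<close>, is returned.\<close>

lemma backtrackE:
  assumes res: "(\<gamma>, K) \<in> backtrack \<tau> \<eta> f x d L \<gamma>max"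
    and par: "\<tau> > 1" "\<eta> > 0" "L > 0"
    and accept: "\<And>K. K > 0 \<Longrightarrow> B \<le> K \<Longrightarrow> \<not> bt_reject f x d (bt_step f x d \<gamma>max K, K)"
  obtains "K > 0" "K \<le> max (\<tau> * B) L" "\<gamma> = bt_step f x d \<gamma>max K" "\<not> bt_reject f x d (\<gamma>, K)"
proof -
  let ?W = "\<lambda>K. while (bt_reject f x d) (\<lambda>(\<gamma>, K). (bt_step f x d \<gamma>max (\<tau> * K), \<tau> * K))
        (bt_step f x d \<gamma>max K, K)"
  obtain K0 where K0: "\<eta> * L \<le> K0" "K0 \<le> L" and eq: "(\<gamma>, K) = ?W K0"
    using res by (auto simp: backtrack_def)
  have "K0 > 0"
    using K0 par by (meson less_le_trans mult_pos_pos)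
  obtain n where "B / K0 < \<tau> ^ n"
    using real_arch_pow[OF par(1)] by blast
  then have n: "B \<le> \<tau> ^ n * K0"
    using \<open>K0 > 0\<close> by (simp add: field_simps)
  \<comment> \<open>Here \<open>n\<close> bounds the number of rejections still possible from
    \<open>K\<close>; the induction unfolds the loop once per rejection.\<close>
  have "\<exists>K'>0. K' \<le> max (\<tau> * B) L \<and> ?W K = (bt_step f x d \<gamma>max K', K')
      \<and> \<not> bt_reject f x d (bt_step f x d \<gamma>max K', K')"
    if "K > 0" "B \<le> \<tau> ^ n * K" "K \<le> max (\<tau> * B) L" for n K
    using that
  proof (induction n arbitrary: K)
    case 0
    then have "\<not> bt_reject f x d (bt_step f x d \<gamma>max K, K)"
      by (intro accept) auto
    with 0 show ?case
      by (intro exI[of _ K]) (auto simp: while_unfold)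
  next
    case (Suc n)
    show ?case
    proof (cases "bt_reject f x d (bt_step f x d \<gamma>max K, K)")
      case True
      then have "K < B"
        using accept[of K] Suc.prems by force
      then have "\<tau> * K \<le> max (\<tau> * B) L"
        using par by (simp add: le_max_iff_disj)
      moreover have "?W K = ?W (\<tau> * K)"
        using True by (subst while_unfold) simp
      ultimately show ?thesis
        using Suc.IH[of "\<tau> * K"] Suc.prems par by (simp add: mult_ac)
    next
      case False
      with Suc.prems show ?thesis
        by (intro exI[of _ K]) (auto simp: while_unfold)
    qed
  qed
  from this[OF \<open>K0 > 0\<close> n] K0 eq that show thesis
    by (auto simp: le_max_iff_disj)
qed

section \<open>Decrease of the gap in one Frank-Wolfe step\<close>

lemma inner_arg_min_le:
  fixes g :: "'a::real_inner"
  assumes v: "is_arg_min (\<lambda>z. g \<bullet> z) (\<lambda>z. z \<in> X) v" and ball: "cball y r \<subseteq> X" and r: "r \<ge> 0"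
  shows "g \<bullet> v \<le> g \<bullet> y - r * norm g"
proof -
  \<comment> \<open>When \<open>g = 0\<close>, division by zero yields 0 and the point is the centre
    \<open>y\<close>, so no case distinction arises.\<close>
  have "y - (r / norm g) *\<^sub>R g \<in> X"
    using ball r by (intro subsetD[OF ball]) (auto simp: dist_norm)
  then have "g \<bullet> v \<le> g \<bullet> (y - (r / norm g) *\<^sub>R g)"
    using v by (simp add: is_arg_min_linorder)
  also have "\<dots> = g \<bullet> y - r * norm g"
    by (simp add: inner_diff_right dot_square_norm power2_eq_square)
  finally show ?thesis .
qed

text \<open>A radius of the ball is a segment of length \<open>r\<close> in \<open>X\<close>. This
  makes the diameter positive and the ratio of \<open>r\<close> to it at most 1.\<close>

lemma radius_le_diameter:
  fixes X :: "'a::euclidean_space set"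
  assumes "bounded X" "cball y r \<subseteq> X" "r \<ge> 0"
  shows "r \<le> diameter X"
proof -
  obtain e :: 'a where e: "norm e = 1"
    using vector_choose_size[of 1] by auto
  have "y \<in> X" "y + r *\<^sub>R e \<in> X"
    using assms(2,3) e by (auto simp: dist_norm subset_iff)
  from diameter_bounded_bound[OF assms(1) this] e assms(3) show ?thesis
    by (simp add: dist_norm)
qed

text \<open>The rate is stated with a uniform bound \<open>Lt\<close> in place of the accepted
  estimate \<open>K\<close>, and membership in \<open>C\<close> is part of the conclusion, so that
  the step can be iterated.\<close>

lemma backtrack_step_contraction:
  fixes f :: "real^'n \<Rightarrow> ereal" and X x0
  defines "C \<equiv> initial_sublevel f X x0"
  assumes f: "closed_convex_fun f" "C3_on_edom f" "open (edom f)"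
    and X: "compact X" "convex X" and x0: "x0 \<in> edom f"
    and xstar: "xstar \<in> C" "\<And>z. z \<in> C \<Longrightarrow> real_of_ereal (f xstar) \<le> real_of_ereal (f z)"
    and r: "r > 0" "cball xstar r \<subseteq> X"
    and x: "x \<in> C" and v: "is_arg_min (\<lambda>z. grad f x \<bullet> z) (\<lambda>z. z \<in> X) v"
    and K: "0 < K" "K \<le> Lt" "L_max f C \<le> Lt"
    and \<gamma>: "\<gamma> = bt_step f x (v - x) 1 K" and acc: "\<not> bt_reject f x (v - x) (\<gamma>, K)"
  shows "x + \<gamma> *\<^sub>R (v - x) \<in> C"
    and "real_of_ereal (f (x + \<gamma> *\<^sub>R (v - x))) - real_of_ereal (f xstar)
      \<le> (real_of_ereal (f x) - real_of_ereal (f xstar)) * (1 - mu_min f C / (2 * Lt) * (r / diameter X)\<^sup>2)"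
proof -
  let ?F = "\<lambda>y. real_of_ereal (f y)" and ?D = "diameter X" and ?m = "mu_min f C"
  define d g h where "d = v - x" and "g = grad f x" and "h = ?F x - ?F xstar"
  let ?y = "x + \<gamma> *\<^sub>R d" and ?N = "norm d"
  have C: "compact C" "convex C" "C \<subseteq> edom f"
    using compact_initial_sublevel[OF f(1) X(1) x0] convex_initial_sublevel[OF f(1) X(2) x0]
    by (auto simp: C_def initial_sublevel_def)
  note C_iff = mem_initial_sublevel_iff[OF f(1) x0, of _ X, folded C_def]
  have vX: "v \<in> X" and xX: "x \<in> X"
    using v x C_iff by (auto simp: is_arg_min_linorder)
  have "g \<bullet> v \<le> g \<bullet> x"
    using v xX by (simp add: is_arg_min_linorder g_def)
  then have descent: "g \<bullet> d \<le> 0"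
    by (simp add: d_def inner_diff_right)
  have \<gamma>_bounds: "0 \<le> \<gamma>" "\<gamma> \<le> 1" "K * \<gamma> * ?N\<^sup>2 \<le> - (g \<bullet> d)"
    using bt_step_bounds[where f=f and x=x and d=d, OF _ K(1)] descent by (auto simp: \<gamma> d_def g_def)
  have y_dom: "?y \<in> edom f" and decr: "?F ?y \<le> ?F x + K * \<gamma>\<^sup>2 / 2 * ?N\<^sup>2 + \<gamma> * (g \<bullet> d)"
    using acc not_bt_reject_iff[OF f(1), of x d \<gamma> K] x C(3) by (auto simp: d_def g_def)
  \<comment> \<open>Half of the linear decrease is guaranteed, whether or not the step was
    truncated.\<close>
  have "K * \<gamma>\<^sup>2 / 2 * ?N\<^sup>2 = \<gamma> / 2 * (K * \<gamma> * ?N\<^sup>2)"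
    by (simp add: power2_eq_square)
  also have "\<dots> \<le> \<gamma> / 2 * (- (g \<bullet> d))"
    using \<gamma>_bounds by (intro mult_left_mono) auto
  finally have half: "?F ?y \<le> ?F x + \<gamma> / 2 * (g \<bullet> d)"
    using decr by simp
  have "\<gamma> / 2 * (g \<bullet> d) \<le> 0"
    using \<gamma>_bounds descent by (simp add: mult_nonneg_nonpos)
  with half have mono: "?F ?y \<le> ?F x" by simp
  have "(1 - \<gamma>) *\<^sub>R x + \<gamma> *\<^sub>R v \<in> X"
    using X(2) xX vX \<gamma>_bounds by (intro convexD) auto
  then have "?y \<in> X"
    by (simp add: d_def algebra_simps)
  with y_dom mono x show "x + \<gamma> *\<^sub>R (v - x) \<in> C"
    unfolding d_def by (simp add: C_iff)
  have h0: "h \<ge> 0"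
    using xstar(2)[OF x] by (simp add: h_def)
  have Lt: "Lt > 0" using K by simp
  have rD: "r \<le> ?D"
    using radius_le_diameter compact_imp_bounded X(1) r by (metis less_imp_le)
  then have D: "?D > 0" using r(1) by simp
  define q where "q = (r / ?D)\<^sup>2"
  have q: "0 \<le> q" "q \<le> 1"
    using rD r(1) D by (auto simp: q_def power_le_one)
  have "?F ?y - ?F xstar \<le> h * (1 - ?m / (2 * Lt) * q)"
  proof (cases "?m > 0")
    case False
    then have "?m / (2 * Lt) * q \<le> 0"
      using Lt q by (simp add: divide_nonpos_nonneg mult_nonpos_nonneg)
    then have "h * 1 \<le> h * (1 - ?m / (2 * Lt) * q)"
      using h0 by (intro mult_left_mono) auto
    with mono show ?thesis by (simp add: h_def)
  next
    case True
    have "h \<le> - (g \<bullet> (xstar - x)) - ?m / 2 * (norm (xstar - x))\<^sup>2"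
      using quadratic_lower_bound[OF f(2,3) C x xstar(1)] by (simp add: h_def g_def)
    also have "\<dots> \<le> g \<bullet> x - g \<bullet> xstar"
      using True by (simp add: inner_diff_right)
    finally have h_le: "h \<le> g \<bullet> x - g \<bullet> xstar" .
    have "g \<bullet> v \<le> g \<bullet> xstar - r * norm g"
      using inner_arg_min_le[OF v r(2)] r(1) by (simp add: g_def)
    with h_le have gap: "h + r * norm g \<le> - (g \<bullet> d)"
      by (simp add: d_def inner_diff_right)
    show ?thesis
    proof (cases "\<gamma> = 1")
      case True
      \<comment> \<open>Together with \<open>q \<le> 1\<close> this makes the claimed factor at
        least 1/2, while a full step leaves at most half of the gap.\<close>
      have "?m \<le> Lt"
        using mu_min_le_L_max[OF f(2) C(1,3)] x K by force
      then have "?m * q \<le> Lt * 1"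
        using q Lt by (intro mult_mono) auto
      then have "1 / 2 \<le> 1 - ?m / (2 * Lt) * q"
        using Lt by (simp add: field_simps)
      then have "h * (1 / 2) \<le> h * (1 - ?m / (2 * Lt) * q)"
        using h0 by (intro mult_left_mono) auto
      moreover have "0 \<le> r * norm g"
        using r(1) by simp
      then have "?F ?y - ?F xstar \<le> h * (1 / 2)"
        using half gap True by (simp add: h_def)
      ultimately show ?thesis by linarith
    next
      case False
      show ?thesis
      proof (cases "d = 0")
        case True
        \<comment> \<open>With \<open>d = 0\<close> the Frank-Wolfe gap vanishes, so
          \<open>x\<close> is already optimal.\<close>
        with gap h0 r(1) have "h = 0"
          by (smt (verit, best) inner_zero_right mult_nonneg_nonneg norm_ge_zero)
        with True show ?thesis by (simp add: h_def)
      next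
        case d: False
        then have N: "?N > 0" by simp
        \<comment> \<open>A step different from 1 was not truncated, so it is the minimizer of the
          quadratic model.\<close>
        have \<gamma>_eq: "\<gamma> = - (g \<bullet> d) / (K * ?N\<^sup>2)"
          using False d by (auto simp: \<gamma> bt_step_def d_def g_def min_def split: if_splits)
        have ND: "?N \<le> ?D"
          using diameter_bounded_bound[OF compact_imp_bounded[OF X(1)] vX xX]
          by (simp add: d_def dist_norm)
        \<comment> \<open>Gradient dominance replaces the gap by the squared gradient norm; then
          \<open>gap\<close> with \<open>h\<close> dropped, \<open>K \<le> Lt\<close> and
          \<open>?N \<le> ?D\<close> lead to the guaranteed decrease.\<close>
        have "?m * q * h / Lt \<le> r\<^sup>2 * (2 * ?m * h) / (2 * Lt * ?D\<^sup>2)"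
          by (simp add: q_def power_divide mult_ac)
        also have "\<dots> \<le> r\<^sup>2 * (norm g)\<^sup>2 / (2 * Lt * ?D\<^sup>2)"
          using gradient_dominance[OF f(2,3) C x xstar(1) True] Lt
          by (intro divide_right_mono mult_left_mono) (auto simp: h_def g_def)
        also have "\<dots> = (r * norm g)\<^sup>2 / (2 * Lt * ?D\<^sup>2)"
          by (simp add: power_mult_distrib)
        also have "\<dots> \<le> (g \<bullet> d)\<^sup>2 / (2 * K * ?N\<^sup>2)"
        proof (rule frac_le)
          have "r * norm g \<le> - (g \<bullet> d)" "0 \<le> r * norm g"
            using gap h0 r(1) by auto
          then have "(r * norm g)\<^sup>2 \<le> (- (g \<bullet> d))\<^sup>2"
            by (rule power_mono)
          then show "(r * norm g)\<^sup>2 \<le> (g \<bullet> d)\<^sup>2" by simp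
          show "2 * K * ?N\<^sup>2 \<le> 2 * Lt * ?D\<^sup>2"
            using K ND by (intro mult_mono power_mono) auto
        qed (use K N in auto)
        also have "\<dots> = - (\<gamma> / 2 * (g \<bullet> d))"
          by (simp add: \<gamma>_eq power2_eq_square)
        finally have "?F ?y - ?F xstar \<le> h - ?m * q * h / Lt"
          using half by (simp add: h_def)
        \<comment> \<open>A short step gains twice what is claimed; the factor 1/2 is given away so
          that one rate also covers full steps.\<close>
        also have "h - ?m * q * h / Lt \<le> h - ?m * q * h / Lt / 2"
        proof (rule diff_left_mono)
          have half_le: "e / 2 \<le> e" if "0 \<le> e" for e :: real
            using that by simp
          show "?m * q * h / Lt / 2 \<le> ?m * q * h / Lt"
            using True q h0 Lt by (intro half_le) simp
        qed
        also have "\<dots> = h * (1 - ?m / (2 * Lt) * q)"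
          by (simp add: algebra_simps)
        finally show ?thesis .
      qed
    qed
  qed
  then show "?F (x + \<gamma> *\<^sub>R (v - x)) - ?F xstar
      \<le> (?F x - ?F xstar) * (1 - ?m / (2 * Lt) * (r / ?D)\<^sup>2)"
    by (simp add: d_def h_def q_def)
qed

section \<open>Linear convergence of the iterates\<close>

theorem theorem2p11:
  fixes f :: "real^'n \<Rightarrow> ereal" and X :: "(real^'n) set"
    and x v :: "nat \<Rightarrow> real^'n" and \<gamma> L :: "nat \<Rightarrow> real"
    and x0 xstar :: "real^'n"
    and M \<nu> \<tau> \<eta> r Linit :: real and t :: nat
  assumes X: "compact X" "convex X"
    and f: "gen_self_concordant M \<nu> f" "\<nu> \<ge> 2"
    and no_line: "\<not> contains_line (edom f)"
    and x0: "x0 \<in> X \<inter> edom f"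
    and xstar: "is_arg_min f (\<lambda>z. z \<in> X) xstar" "xstar \<in> interior (X \<inter> edom f)"
    and r: "r > 0" "ball xstar r \<subseteq> X \<inter> edom f"
      "\<And>s. ball xstar s \<subseteq> X \<inter> edom f \<Longrightarrow> s \<le> r"
    and params: "\<tau> > 1" "0 < \<eta>" "\<eta> \<le> 1" "Linit > 0"
    and run: "bfw_run \<tau> \<eta> f X x0 Linit x v \<gamma> L"
    and t: "t \<ge> 1"
  defines "L0 \<equiv> initial_sublevel f X x0"
  defines "Ltilde \<equiv> max (\<tau> * L_max f L0) Linit"
  shows "primal_gap f xstar (x t)
    \<le> primal_gap f xstar x0 * ereal ((1 - mu_min f L0 / (2 * Ltilde) * (r / diameter X)\<^sup>2) ^ t)"
proof -
  let ?F = "\<lambda>y. real_of_ereal (f y)"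
  define c where "c = 1 - mu_min f L0 / (2 * Ltilde) * (r / diameter X)\<^sup>2"
  have fc: "closed_convex_fun f" "C3_on_edom f" "open (edom f)"
    using f(1) by (auto simp: gen_self_concordant_def)
  have x0': "x0 \<in> edom f" and x0_L0: "x0 \<in> L0"
    using x0 by (auto simp: L0_def initial_sublevel_def)
  have L0: "compact L0" "L0 \<subseteq> edom f"
    using compact_initial_sublevel[OF fc(1) X(1) x0'] by (auto simp: L0_def initial_sublevel_def)
  have xs: "xstar \<in> L0"
    using xstar x0 interior_subset[of "X \<inter> edom f"]
    by (auto simp: L0_def initial_sublevel_def is_arg_min_linorder)
  have xs_min: "?F xstar \<le> ?F z" if "z \<in> L0" for z
  proof -
    have "f xstar \<le> f z"
      using xstar(1) that by (auto simp: L0_def initial_sublevel_def is_arg_min_linorder)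
    then show ?thesis
      using ereal_real_of_edom[OF fc(1)] xs that L0(2) by (metis ereal_less_eq(3) subsetD)
  qed
  \<comment> \<open>The comparison point for the linear minimizer lies on the boundary of the ball,
    so the closed ball is needed; \<open>X\<close> contains it because \<open>X\<close> is
    closed.\<close>
  have "closure (ball xstar r) \<subseteq> X"
    using r(2) X(1) by (intro closure_minimal compact_imp_closed) auto
  then have cball: "cball xstar r \<subseteq> X"
    using r(1) by simp
  have Lt: "Ltilde > 0"
    using params by (simp add: Ltilde_def)
  have L_max_le: "L_max f L0 \<le> Ltilde"
  proof (cases "L_max f L0 > 0")
    case True
    then have "1 * L_max f L0 \<le> \<tau> * L_max f L0"
      using params by (intro mult_right_mono) auto
    then show ?thesis by (simp add: Ltilde_def)
  qed (use Lt in linarith)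
  \<comment> \<open>Nonnegativity allows the induction hypothesis to be multiplied by
    \<open>c\<close>.\<close>
  have c0: "c \<ge> 0"
  proof -
    have "mu_min f L0 \<le> Ltilde"
      using mu_min_le_L_max[OF fc(2) L0] x0_L0 L_max_le by force
    moreover have "(r / diameter X)\<^sup>2 \<le> 1"
      using radius_le_diameter[OF compact_imp_bounded[OF X(1)] cball] r(1)
      by (simp add: power_le_one)
    ultimately have "mu_min f L0 * (r / diameter X)\<^sup>2 \<le> Ltilde * 1"
      using Lt by (intro mult_mono) auto
    then have "mu_min f L0 * (r / diameter X)\<^sup>2 \<le> 2 * Ltilde"
      using Lt by linarith
    then have "mu_min f L0 * (r / diameter X)\<^sup>2 / (2 * Ltilde) \<le> 1"
      using Lt by (simp only: pos_divide_le_eq mult_1_left)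
    then show ?thesis
      by (simp add: c_def)
  qed
  \<comment> \<open>The induction also carries membership in \<open>L0\<close> and the bounds on the
    estimate. By the index shift, \<open>L t\<close> is the estimate entering iteration
    \<open>t\<close>, which starts from \<open>Linit\<close>.\<close>
  have "x t \<in> L0 \<and> 0 < L t \<and> L t \<le> Ltilde \<and> ?F (x t) - ?F xstar \<le> (?F x0 - ?F xstar) * c ^ t" for t
  proof (induction t)
    case 0
    show ?case
      using run params x0_L0 by (simp add: bfw_run_def Ltilde_def)
  next
    case (Suc t)
    then have IH: "x t \<in> L0" "0 < L t" "L t \<le> Ltilde"
      "?F (x t) - ?F xstar \<le> (?F x0 - ?F xstar) * c ^ t" by auto
    have v: "is_arg_min (\<lambda>z. grad f (x t) \<bullet> z) (\<lambda>z. z \<in> X) (v t)"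
      and bt: "(\<gamma> t, L (Suc t)) \<in> backtrack \<tau> \<eta> f (x t) (v t - x t) (L t) 1"
      and x_Suc: "x (Suc t) = x t + \<gamma> t *\<^sub>R (v t - x t)"
      using run by (auto simp: bfw_run_def)
    have xX: "x t \<in> X" using IH(1) by (simp add: L0_def initial_sublevel_def)
    have descent: "grad f (x t) \<bullet> (v t - x t) \<le> 0" and vX: "x t + (v t - x t) \<in> X"
      using v xX by (auto simp: is_arg_min_linorder inner_diff_right)
    have accept: "\<not> bt_reject f (x t) (v t - x t) (bt_step f (x t) (v t - x t) 1 K, K)"
      if "K > 0" "L_max f L0 \<le> K" for K
      using not_bt_reject_ge_L_max[OF fc X x0' _ vX descent that(1)] IH(1) that(2)
      by (simp add: L0_def)
    have L': "0 < L (Suc t)" "L (Suc t) \<le> max (\<tau> * L_max f L0) (L t)"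
      "\<gamma> t = bt_step f (x t) (v t - x t) 1 (L (Suc t))"
      "\<not> bt_reject f (x t) (v t - x t) (\<gamma> t, L (Suc t))"
      using backtrackE[OF bt params(1,2) IH(2) accept] by blast+
    have L'_le: "L (Suc t) \<le> Ltilde"
      using L'(2) IH(3) by (simp add: Ltilde_def)
    note step = backtrack_step_contraction[OF fc X x0' xs[unfolded L0_def] xs_min[unfolded L0_def]
        r(1) cball IH(1)[unfolded L0_def] v L'(1) L'_le L_max_le[unfolded L0_def] L'(3,4),
        folded L0_def, folded x_Suc c_def]
    have "?F (x (Suc t)) - ?F xstar \<le> (?F (x t) - ?F xstar) * c"
      using step(2) by simp
    also have "\<dots> \<le> (?F x0 - ?F xstar) * c ^ t * c"
      using IH(4) c0 by (rule mult_right_mono)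
    finally show ?case
      using step(1) L'(1) L'_le by (simp add: mult_ac)
  qed
  then have xt: "x t \<in> L0" and le: "?F (x t) - ?F xstar \<le> (?F x0 - ?F xstar) * c ^ t" by auto
  \<comment> \<open>On \<open>L0\<close> both values are finite, so the extended-real claim reduces
    to the real inequality.\<close>
  have gap: "primal_gap f xstar z = ereal (?F z - ?F xstar)" if "z \<in> L0" for z
    using ereal_real_of_edom[OF fc(1)] xs that L0(2)
    unfolding primal_gap_def by (metis ereal_minus(1) subsetD)
  show ?thesis
    using le by (simp add: gap xt x0_L0 c_def)
qed

end
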